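(* Let $G=K_{p_1,p_2,\dots,p_k}$ with $k\ge 2$ and $p_1\ge p_2\ge\dots\ge p_k\ge 1$, and let $n=p_1+\dots+p_k$. Let $q$ be an integer with $n-3\le q\le n-1$ and $q\ge 2$. If $(G,q)$ is not one of the pairs $(K_{3,3},4)$, $(K_{4,3},4)$, $(K_{3,3,3},6)$, then $$\ell_q(G)=|E(G)|-\min_{S\in\mathcal{P}_{n-q+1}(G)}|E_G(S)|.$$
   Context: $K_{p_1,\dots,p_k}$ is the complete $k$-partite graph with partite sets of sizes $p_1,\dots,p_k$. For a graph $H$ with components $H_1,\dots,H_s$ ordered so that $|V(H_1)|\ge\dots\ge|V(H_s)|$, write $or_i(H)=|V(H_i)|$. $\ell_q(G)$ is the maximum number of edges of a disconnected spanning subgraph $H$ of $G$ with $or_1(H)+or_2(H)\le q$ (any two components together have at most $q$ vertices). $\mathcal{P}_r(G)$ is the family of $r$-element subsets of $V(G)$. For $S\subseteq V(G)$, $E_G(S)$ is the set of edges of $G$ incident with at least one vertex of $S$. *)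

theory Defs
  imports Main "HOL-Library.Multiset" "HOL-Library.Disjoint_Sets" "HOL-Library.Ramsey"
begin

text \<open>Undirected graphs, an edge being the set of its endpoints.\<close>

record 'a ugraph =
  verts :: "'a set"
  edges :: "'a set set"

definition spanning_subgraph :: "'a ugraph \<Rightarrow> 'a ugraph \<Rightarrow> bool" where
  "spanning_subgraph H G \<longleftrightarrow> verts H = verts G \<and> edges H \<subseteq> edges G"

definition reachable :: "'a ugraph \<Rightarrow> 'a \<Rightarrow> 'a \<Rightarrow> bool" where
  "reachable G u v \<longleftrightarrow> (u, v) \<in> {(x, y). {x, y} \<in> edges G}\<^sup>*"

definition connected_graph :: "'a ugraph \<Rightarrow> bool" where
  "connected_graph G \<longleftrightarrow> (\<forall>u\<in>verts G. \<forall>v\<in>verts G. reachable G u v)"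

text \<open>A component is represented by its vertex set.\<close>

definition components :: "'a ugraph \<Rightarrow> 'a set set" where
  "components G = {{v \<in> verts G. reachable G u v} | u. u \<in> verts G}"

text \<open>
  The orders of the components with multiplicity, in non-increasing order. In
  \<open>comp_order i\<close> the index \<open>i\<close> starts at 1; the value is only meaningful for
  \<open>i\<close> up to the number of components, so for \<open>i = 2\<close> the graph must be disconnected.
\<close>

definition comp_orders :: "'a ugraph \<Rightarrow> nat list" where
  "comp_orders G =
     rev (sorted_list_of_multiset (image_mset card (mset_set (components G))))"

definition comp_order :: "nat \<Rightarrow> 'a ugraph \<Rightarrow> nat" where
  "comp_order i G = comp_orders G ! (i - 1)"

text \<open>
  For a finite graph \<open>G\<close> with at least two vertices and \<open>q \<ge> 2\<close> the set below is finite
  and nonempty: it contains the number of edges of the edgeless spanning subgraph.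
\<close>

definition ell :: "nat \<Rightarrow> 'a ugraph \<Rightarrow> nat" where
  "ell q G = Max {card (edges H) | H. spanning_subgraph H G \<and> \<not> connected_graph H \<and>
                    comp_order 1 H + comp_order 2 H \<le> q}"

definition incident_edges :: "'a ugraph \<Rightarrow> 'a set \<Rightarrow> 'a set set" where
  "incident_edges G S = {e \<in> edges G. e \<inter> S \<noteq> {}}"

text \<open>
  \<open>complete_multipartite ps G\<close>: \<open>G\<close> is (a copy of) the complete multipartite graph whose
  partite sets have the sizes listed in \<open>ps\<close>.
\<close>

definition complete_multipartite :: "nat list \<Rightarrow> 'a ugraph \<Rightarrow> bool" where
  "complete_multipartite ps G \<longleftrightarrow>
     (\<exists>A :: nat \<Rightarrow> 'a set.
        (\<forall>i<length ps. finite (A i) \<and> card (A i) = ps ! i) \<and>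
        disjoint_family_on A {..<length ps} \<and>
        verts G = (\<Union>i<length ps. A i) \<and>
        edges G = {{u, v} | u v i j. i < length ps \<and> j < length ps \<and> i \<noteq> j \<and>
                                     u \<in> A i \<and> v \<in> A j})"

lemma complete_multipartite_simple:
  assumes "complete_multipartite ps G"
  shows "finite (verts G)" and "edges G \<subseteq> nsets (verts G) 2"
  using assms unfolding complete_multipartite_def nsets_def disjoint_family_on_def
  by (auto simp: card_2_iff) blast+

end

theory Submission
  imports Defs
begin

text \<open>
  Deleting all edges at a set of \<open>n - q + 1\<close> vertices gives a feasible subgraph, so the content is
  the upper bound: for every partition of the vertices into at least two blocks, any two of
  total size at most \<open>q\<close>, some \<open>q - 1\<close> vertices span at least as many edges as the blocks do together.
  If \<open>|Y| \<le> |X|\<close>, some vertex of \<open>Y\<close> can be moved to \<open>X\<close> without losing edges inside the blocks,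
  by averaging over the partite sets that meet \<open>Y\<close>. Hence the largest block can absorb vertices of the
  others until these have any prescribed smaller sizes. With \<open>m = n - q\<close>, at least \<open>m + 2\<close> blocks reduce
  to one block and \<open>m + 1\<close> singletons. Since \<open>m \<le> 3\<close>, what remains is one big block together
  with blocks of sizes \<open>2, 2\<close> or \<open>2, 2, 1\<close> or \<open>3, 3\<close>; there one or two outside vertices are added to the
  big block, which fails only in the three exceptional graphs.
\<close>

subsection \<open>Edges of a complete multipartite graph inside a vertex set\<close>

text \<open>
  The function \<open>p\<close> sends a vertex to its partite set, so \<open>cross_edges p T\<close> are the edges that the
  complete multipartite graph has inside \<open>T\<close>.
\<close>

definition cross_edges :: "('a \<Rightarrow> 'b) \<Rightarrow> 'a set \<Rightarrow> 'a set set" where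
  "cross_edges p T = {{u, v} | u v. u \<in> T \<and> v \<in> T \<and> p u \<noteq> p v}"

definition ecount :: "('a \<Rightarrow> 'b) \<Rightarrow> 'a set \<Rightarrow> nat" where
  "ecount p T = card (cross_edges p T)"

text \<open>For \<open>v\<close> outside \<open>X\<close> this is the number of edges joining
  \<open>v\<close> to \<open>X\<close>; for \<open>v\<close> in \<open>X\<close> it is the degree of
  \<open>v\<close> inside \<open>X\<close>, since \<open>v\<close> does not count itself. The same
  expression thus measures both gain and loss when a vertex changes block.\<close>

definition deg_into :: "('a \<Rightarrow> 'b) \<Rightarrow> 'a set \<Rightarrow> 'a \<Rightarrow> nat" where
  "deg_into p X v = card {x \<in> X. p x \<noteq> p v}"

lemma doubleton_in_cross_edges [simp]:
  "{u, v} \<in> cross_edges p T \<longleftrightarrow> u \<in> T \<and> v \<in> T \<and> p u \<noteq> p v"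
  unfolding cross_edges_def by (auto simp: doubleton_eq_iff)

lemma finite_cross_edges: "finite T \<Longrightarrow> finite (cross_edges p T)"
  by (rule finite_subset[of _ "Pow T"]) (auto simp: cross_edges_def)

lemma cross_edges_mono: "S \<subseteq> T \<Longrightarrow> cross_edges p S \<subseteq> cross_edges p T"
  by (fastforce simp: cross_edges_def)

lemma ecount_mono: "S \<subseteq> T \<Longrightarrow> finite T \<Longrightarrow> ecount p S \<le> ecount p T"
  unfolding ecount_def by (intro card_mono finite_cross_edges cross_edges_mono)

lemma ecount_empty [simp]: "ecount p {} = 0"
  by (simp add: ecount_def cross_edges_def)

lemma deg_into_empty [simp]: "deg_into p {} v = 0"
  by (simp add: deg_into_def)

lemma deg_into_insert [simp]:
  assumes "finite X" "x \<notin> X"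
  shows "deg_into p (insert x X) v = (if p x \<noteq> p v then Suc (deg_into p X v) else deg_into p X v)"
proof -
  have "{y \<in> insert x X. p y \<noteq> p v} =
      (if p x \<noteq> p v then insert x {y \<in> X. p y \<noteq> p v} else {y \<in> X. p y \<noteq> p v})"
    by auto
  with assms show ?thesis by (simp add: deg_into_def)
qed

lemma ecount_insert [simp]:
  assumes "finite X" "v \<notin> X"
  shows "ecount p (insert v X) = ecount p X + deg_into p X v"
proof -
  have eq: "cross_edges p (insert v X) = cross_edges p X \<union> (\<lambda>x. {v, x}) ` {x \<in> X. p x \<noteq> p v}"
    by (fastforce simp: cross_edges_def)
  have disj: "cross_edges p X \<inter> (\<lambda>x. {v, x}) ` {x \<in> X. p x \<noteq> p v} = {}"
    using assms by (auto simp: cross_edges_def doubleton_eq_iff)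
  have inj: "inj_on (\<lambda>x. {v, x}) {x \<in> X. p x \<noteq> p v}"
    by (auto simp: inj_on_def doubleton_eq_iff)
  show ?thesis
    unfolding ecount_def eq deg_into_def
    using assms disj inj by (simp add: card_Un_disjoint card_image finite_cross_edges)
qed

lemma ecount_le_1:
  assumes "finite T" "card T \<le> 1"
  shows "ecount p T = 0"
proof -
  from assms have "T = {} \<or> (\<exists>v. T = {v})"
    by (metis card_0_eq card_1_singletonE le_neq_implies_less less_one)
  then show ?thesis by auto
qed

section \<open>Degrees into a block, and moving vertices between blocks\<close>

lemma card_class_plus_deg_into: "finite X \<Longrightarrow> card {x \<in> X. p x = p v} + deg_into p X v = card X"
  unfolding deg_into_def
  by (subst card_Un_disjoint[symmetric]) (auto intro: arg_cong[where f = card])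

text \<open>Every \<open>x\<close> in \<open>X\<close> lies outside the class of \<open>u\<close> or
  outside that of \<open>v\<close>.\<close>

lemma deg_into_two: "finite X \<Longrightarrow> p u \<noteq> p v \<Longrightarrow> card X \<le> deg_into p X u + deg_into p X v"
  by (induction X rule: finite_induct) auto

text \<open>Every \<open>x\<close> in \<open>X\<close> lies in at most one of the three classes, so
  it is counted at least twice.\<close>

lemma deg_into_three:
  "finite X \<Longrightarrow> p u \<noteq> p v \<Longrightarrow> p v \<noteq> p w \<Longrightarrow> p u \<noteq> p w \<Longrightarrow>
    2 * card X \<le> deg_into p X u + deg_into p X v + deg_into p X w"
  by (induction X rule: finite_induct) auto

text \<open>If \<open>X\<close> and \<open>Y\<close> are disjoint, moving \<open>v\<close> from
  \<open>Y\<close> to \<open>X\<close> loses \<open>deg_into p Y v\<close> edges and gains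
  \<open>deg_into p X v\<close>; the vertex found here can be moved without a net loss.\<close>

lemma ex_deg_into_le:
  assumes fin: "finite X" "finite Y" and le: "card Y \<le> card X" and ne: "Y \<noteq> {}"
  shows "\<exists>v\<in>Y. deg_into p Y v \<le> deg_into p X v"
proof (rule ccontr)
  assume neg: "\<not> ?thesis"
  \<comment> \<open>Otherwise every partite set meeting \<open>Y\<close> meets \<open>X\<close> in more than \<open>|X| - |Y|\<close> extra vertices.\<close>
  define c where "c Z i = int (card {z \<in> Z. p z = i})" for Z i
  have csum: "(\<Sum>i\<in>p ` Y. c Z i) = int (card {z \<in> Z. p z \<in> p ` Y})" if "finite Z" for Z
  proof -
    have "card (\<Union>i\<in>p ` Y. {z \<in> Z. p z = i}) = (\<Sum>i\<in>p ` Y. card {z \<in> Z. p z = i})"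
      using fin that by (intro card_UN_disjoint) auto
    moreover have "(\<Union>i\<in>p ` Y. {z \<in> Z. p z = i}) = {z \<in> Z. p z \<in> p ` Y}" by auto
    ultimately show ?thesis by (simp add: c_def)
  qed
  define a where "a = int (card X) - int (card Y)"
  have "a + 1 \<le> c X i - c Y i" if "i \<in> p ` Y" for i
  proof -
    from that obtain v where v: "v \<in> Y" "i = p v" by auto
    with neg have "deg_into p X v < deg_into p Y v" by auto
    with card_class_plus_deg_into[OF fin(1), of p v] card_class_plus_deg_into[OF fin(2), of p v] v show ?thesis
      by (simp add: c_def a_def)
  qed
  \<comment> \<open>The surpluses add up to at most \<open>a\<close>, because the classes meeting
    \<open>Y\<close> cover all of \<open>Y\<close> and at most all of \<open>X\<close>. But there is
    at least one such class, and each has surplus at least \<open>a + 1\<close>.\<close>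
  then have "(\<Sum>i\<in>p ` Y. a + 1) \<le> (\<Sum>i\<in>p ` Y. c X i - c Y i)" by (rule sum_mono)
  also have "\<dots> = int (card {z \<in> X. p z \<in> p ` Y}) - int (card {z \<in> Y. p z \<in> p ` Y})"
    by (simp add: sum_subtractf csum fin)
  also have "{z \<in> Y. p z \<in> p ` Y} = Y" by auto
  also have "int (card {z \<in> X. p z \<in> p ` Y}) \<le> int (card X)"
    using fin by (simp add: card_mono)
  finally have "int (card (p ` Y)) * (a + 1) \<le> a" by (simp add: a_def)
  moreover have "card (p ` Y) \<ge> 1" using ne fin by (simp add: Suc_le_eq card_gt_0_iff)
  moreover have "a \<ge> 0" using le by (simp add: a_def)
  ultimately have "1 * (a + 1) \<le> int (card (p ` Y)) * (a + 1)"
    by (intro mult_right_mono) auto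
  with \<open>int (card (p ` Y)) * (a + 1) \<le> a\<close> show False by simp
qed

text \<open>Induction on the number of vertices still to be moved. Each move enlarges
  \<open>X\<close> and shrinks \<open>Y\<close>, so \<open>card Y \<le> card X\<close> persists and
  \<open>ex_deg_into_le\<close> applies again.\<close>

lemma drain:
  assumes "finite X" "finite Y" "X \<inter> Y = {}" "t \<le> card Y" "card Y \<le> card X"
  shows "\<exists>X' Y'. X' \<union> Y' = X \<union> Y \<and> X' \<inter> Y' = {} \<and> card Y' = t \<and> card X \<le> card X' \<and>
    ecount p X + ecount p Y \<le> ecount p X' + ecount p Y'"
  using assms
proof (induction "card Y - t" arbitrary: X Y)
  case 0
  then show ?case by (intro exI[of _ X] exI[of _ Y]) auto
next
  case (Suc k)
  then have "Y \<noteq> {}" by auto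
  with ex_deg_into_le[of X Y p] Suc.prems obtain v where v: "v \<in> Y" "deg_into p Y v \<le> deg_into p X v" by auto
  define Z where "Z = Y - {v}"
  have Z: "Y = insert v Z" "v \<notin> Z" "finite Z" using v Suc.prems by (auto simp: Z_def)
  have vX: "v \<notin> X" using v Suc.prems by auto
  have cZ: "card Y = Suc (card Z)" using Z by simp
  have "\<exists>X' Y'. X' \<union> Y' = insert v X \<union> Z \<and> X' \<inter> Y' = {} \<and> card Y' = t \<and>
      card (insert v X) \<le> card X' \<and>
      ecount p (insert v X) + ecount p Z \<le> ecount p X' + ecount p Y'"
    using Suc.prems Suc.hyps(2) Z cZ vX by (intro Suc.hyps(1)) auto
  then obtain X' Y' where *: "X' \<union> Y' = insert v X \<union> Z" "X' \<inter> Y' = {}" "card Y' = t"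
      "card (insert v X) \<le> card X'"
      "ecount p (insert v X) + ecount p Z \<le> ecount p X' + ecount p Y'" by auto
  have "ecount p X + ecount p Y \<le> ecount p (insert v X) + ecount p Z"
    using Z vX v Suc.prems by simp
  with * Z vX Suc.prems show ?case by (intro exI[of _ X'] exI[of _ Y']) auto
qed

text \<open>The blocks are drained into \<open>X\<close> one after another; \<open>X\<close> never
  shrinks, so it stays at least as large as each block still untouched. The blocks form an indexed
  family, not a set, because several of them may be drained to the empty set.\<close>

lemma drain_family:
  assumes "finite D" "finite X" "\<And>i. i \<in> D \<Longrightarrow> finite (F i)" "disjoint_family_on F D"
    "\<And>i. i \<in> D \<Longrightarrow> X \<inter> F i = {}" "\<And>i. i \<in> D \<Longrightarrow> t i \<le> card (F i)"
    "\<And>i. i \<in> D \<Longrightarrow> card (F i) \<le> card X"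
  shows "\<exists>X' F'. X' \<union> (\<Union>i\<in>D. F' i) = X \<union> (\<Union>i\<in>D. F i) \<and> disjoint_family_on F' D \<and>
    (\<forall>i\<in>D. X' \<inter> F' i = {} \<and> card (F' i) = t i) \<and> card X \<le> card X' \<and>
    ecount p X + (\<Sum>i\<in>D. ecount p (F i)) \<le> ecount p X' + (\<Sum>i\<in>D. ecount p (F' i))"
  using assms
proof (induction D rule: finite_induct)
  case empty
  then show ?case by auto
next
  case (insert d D)
  have "disjoint_family_on F D"
    using insert.prems(3) by (rule disjoint_family_on_mono[rotated]) auto
  then have "\<exists>X' F'. X' \<union> (\<Union>i\<in>D. F' i) = X \<union> (\<Union>i\<in>D. F i) \<and> disjoint_family_on F' D \<and>
    (\<forall>i\<in>D. X' \<inter> F' i = {} \<and> card (F' i) = t i) \<and> card X \<le> card X' \<and>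
    ecount p X + (\<Sum>i\<in>D. ecount p (F i)) \<le> ecount p X' + (\<Sum>i\<in>D. ecount p (F' i))"
    using insert.prems by (intro insert.IH) auto
  then obtain X' F' where
    IH: "X' \<union> (\<Union>i\<in>D. F' i) = X \<union> (\<Union>i\<in>D. F i)" "disjoint_family_on F' D"
      "\<forall>i\<in>D. X' \<inter> F' i = {} \<and> card (F' i) = t i" "card X \<le> card X'"
      "ecount p X + (\<Sum>i\<in>D. ecount p (F i)) \<le> ecount p X' + (\<Sum>i\<in>D. ecount p (F' i))"
    by auto
  have Fd: "F d \<inter> (X \<union> (\<Union>i\<in>D. F i)) = {}"
    using insert.prems(3) insert.prems(4)[of d] insert.hyps
    by (fastforce simp: disjoint_family_on_def)
  have fin: "finite (X' \<union> (\<Union>i\<in>D. F' i))"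
    unfolding IH(1) using insert.prems insert.hyps by auto
  have dX: "X' \<inter> F d = {}" using Fd IH(1) by blast
  have "card (F d) \<le> card X'" using insert.prems(6)[of d] IH(4) by simp
  with drain[of X' "F d" "t d" p] dX fin insert.prems obtain X'' Y where
    D: "X'' \<union> Y = X' \<union> F d" "X'' \<inter> Y = {}" "card Y = t d" "card X' \<le> card X''"
      "ecount p X' + ecount p (F d) \<le> ecount p X'' + ecount p Y" by auto
  \<comment> \<open>Draining \<open>F d\<close> only redistributes the vertices of \<open>X'\<close>
    and \<open>F d\<close>, and both sets avoid the blocks drained earlier.\<close>
  have out: "F' i \<inter> (X'' \<union> Y) = {}" if "i \<in> D" for i
    unfolding D(1) using that IH(1,3) Fd by blast
  define F'' where "F'' = F'(d := Y)"
  have eq: "F'' d = Y" "\<And>i. i \<in> D \<Longrightarrow> F'' i = F' i"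
    using insert.hyps by (auto simp: F''_def)
  have "(\<Sum>i\<in>D. ecount p (F'' i)) = (\<Sum>i\<in>D. ecount p (F' i))" using eq by auto
  then have "ecount p X + (\<Sum>i\<in>insert d D. ecount p (F i))
      \<le> ecount p X'' + (\<Sum>i\<in>insert d D. ecount p (F'' i))"
    using IH(5) D(5) insert.hyps eq by simp
  moreover have "(\<Union>i\<in>insert d D. F'' i) = Y \<union> (\<Union>i\<in>D. F' i)" using eq by auto
  then have "X'' \<union> (\<Union>i\<in>insert d D. F'' i) = X \<union> (\<Union>i\<in>insert d D. F i)"
    using D(1) IH(1) by auto
  moreover have "disjoint_family_on F'' (insert d D)"
    using IH(2) out eq by (auto simp: disjoint_family_on_def)
  moreover have "\<forall>i\<in>insert d D. X'' \<inter> F'' i = {} \<and> card (F'' i) = t i"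
    using D out eq IH(3) by auto
  ultimately show ?case using IH(4) D(4) by (intro exI[of _ X''] exI[of _ F'']) auto
qed

subsection \<open>Enlarging the big block\<close>

lemma card_2_ecount:
  assumes "card Y = 2" "ecount p Y \<noteq> 0"
  obtains u v where "Y = {u, v}" "u \<noteq> v" "p u \<noteq> p v" "ecount p Y = 1"
proof -
  from assms(1) obtain u v where "Y = {u, v}" "u \<noteq> v" by (auto simp: card_2_iff)
  with assms that show ?thesis by (auto split: if_splits)
qed

lemma ecount_card_2_le: "card Y = 2 \<Longrightarrow> ecount p Y \<le> 1"
  using card_2_ecount[of Y p] by fastforce

text \<open>Here \<open>m\<close> stands for the number of edges in a second pair. As
  \<open>Y\<close> is a single edge, adding \<open>y\<close> from \<open>Y\<close> to
  \<open>X\<close> suffices once \<open>y\<close> has degree at least \<open>m + 1\<close> into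
  \<open>X\<close>. The two degrees sum to at least \<open>card X\<close>, so this fails only in a
  tight configuration on two vertices of \<open>X\<close>.\<close>

lemma extend_pair_pair_aux:
  assumes fin: "finite V" and sub: "X \<subseteq> V" "Y \<subseteq> V" and disj: "X \<inter> Y = {}"
    and card: "card Y = 2" "2 \<le> card X"
    and le: "m \<le> ecount p Y" "ecount p Y \<noteq> 0"
  shows "(\<exists>T\<subseteq>V. card T = card X + 1 \<and> ecount p X + ecount p Y + m \<le> ecount p T) \<or>
    card X = 2 \<and> ecount p X = 1 \<and> m = 1 \<and>
    (\<forall>u\<in>V. \<forall>v\<in>V. \<forall>w\<in>V. p u = p v \<or> p u = p w \<or> p v = p w)"
proof -
  have finX: "finite X" using fin sub finite_subset by blast
  from card le obtain u v where Y: "Y = {u, v}" "u \<noteq> v" "p u \<noteq> p v" "ecount p Y = 1"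
    using card_2_ecount by metis
  have uv: "u \<notin> X" "v \<notin> X" "u \<in> V" "v \<in> V" using Y disj sub by auto
  have grow: ?thesis if "y \<in> V" "y \<notin> X" "m + 1 \<le> deg_into p X y" for y
  proof -
    have "insert y X \<subseteq> V \<and> card (insert y X) = card X + 1 \<and>
        ecount p X + ecount p Y + m \<le> ecount p (insert y X)"
      using that sub finX Y by simp
    then show ?thesis by blast
  qed
  have sum: "card X \<le> deg_into p X u + deg_into p X v" using deg_into_two finX Y by metis
  show ?thesis
  proof (cases "m + 1 \<le> deg_into p X u \<or> m + 1 \<le> deg_into p X v")
    case True
    then show ?thesis using grow[of u] grow[of v] uv by blast
  next
    case False
    \<comment> \<open>Both degrees are at most \<open>m \<le> 1\<close> and their sum is at least
      \<open>card X \<ge> 2\<close>, so equality holds throughout.\<close>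
    then have m: "m = 1" "card X = 2" "deg_into p X u = 1" "deg_into p X v = 1"
      using sum card le Y by auto
    from m obtain a b where ab: "X = {a, b}" "a \<noteq> b" by (auto simp: card_2_iff)
    then have "p a \<noteq> p b" using m by (auto split: if_splits)
    then have X1: "ecount p X = 1" using ab by simp
    show ?thesis
    proof (rule disjCI)
      assume neg: "\<not> (card X = 2 \<and> ecount p X = 1 \<and> m = 1 \<and>
        (\<forall>u\<in>V. \<forall>v\<in>V. \<forall>w\<in>V. p u = p v \<or> p u = p w \<or> p v = p w))"
      \<comment> \<open>If \<open>V\<close> meets three classes, a triangle replaces
        \<open>X\<close> altogether: its three edges match the one edge each of \<open>X\<close>,
        \<open>Y\<close> and the second pair.\<close>
      then obtain r s t where rst: "r \<in> V" "s \<in> V" "t \<in> V" "p r \<noteq> p s" "p r \<noteq> p t" "p s \<noteq> p t"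
        using m X1 by auto
      then have "r \<noteq> s" "r \<noteq> t" "s \<noteq> t" by auto
      with rst have "{r, s, t} \<subseteq> V \<and> card {r, s, t} = card X + 1 \<and>
          ecount p X + ecount p Y + m \<le> ecount p {r, s, t}"
        using m X1 Y(4) by simp
      then show "\<exists>T\<subseteq>V. card T = card X + 1 \<and> ecount p X + ecount p Y + m \<le> ecount p T" by blast
    qed
  qed
qed

text \<open>Trades two pairs for one further vertex. A pair carrying an edge takes the role of
  \<open>Y\<close> in \<open>extend_pair_pair_aux\<close>; if both pairs are edgeless, any vertex of
  theirs will do. \<open>V\<close> may exceed the three blocks, which leaves room for an additional
  singleton block.\<close>

lemma extend_pair_pair:
  assumes fin: "finite V" and sub: "X \<subseteq> V" "Y \<subseteq> V" "Z \<subseteq> V"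
    and disj: "X \<inter> Y = {}" "X \<inter> Z = {}" and card: "card Y = 2" "card Z = 2" "2 \<le> card X"
  shows "(\<exists>T\<subseteq>V. card T = card X + 1 \<and> ecount p X + ecount p Y + ecount p Z \<le> ecount p T) \<or>
    card X = 2 \<and> ecount p X = 1 \<and> ecount p Y = 1 \<and> ecount p Z = 1 \<and>
    (\<forall>u\<in>V. \<forall>v\<in>V. \<forall>w\<in>V. p u = p v \<or> p u = p w \<or> p v = p w)"
proof -
  have Y: "ecount p Y \<le> 1" and Z: "ecount p Z \<le> 1" using card ecount_card_2_le by auto
  consider "ecount p Y = 0" "ecount p Z = 0" | "ecount p Y = 1" | "ecount p Z = 1" "ecount p Y = 0"
    using Y Z by linarith
  then show ?thesis
  proof cases
    case 1
    from card obtain y where y: "y \<in> Y" by fastforce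
    have finX: "finite X" using fin sub finite_subset by blast
    have "insert y X \<subseteq> V \<and> card (insert y X) = card X + 1 \<and>
        ecount p X + ecount p Y + ecount p Z \<le> ecount p (insert y X)"
    proof -
      have "y \<notin> X" "y \<in> V" using y sub disj by auto
      then show ?thesis using 1 sub finX by simp
    qed
    then show ?thesis by blast
  next
    case 2
    with extend_pair_pair_aux[OF fin sub(1,2) disj(1) card(1,3), of "ecount p Z" p] Z
    show ?thesis by auto
  next
    case 3
    with extend_pair_pair_aux[OF fin sub(1,3) disj(2) card(2,3), of "ecount p Y" p] Z
    show ?thesis by auto
  qed
qed

text \<open>The classes split three vertices as 3, 2+1 or 1+1+1, which gives 0, 2 or 3 edges; a
  single edge is impossible.\<close>

lemma card_3_ecount:
  assumes "card Y = 3"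
  shows "ecount p Y = 0 \<or>
    ecount p Y = 2 \<and> (\<exists>u\<in>Y. \<exists>v\<in>Y. p u \<noteq> p v) \<or>
    ecount p Y = 3 \<and> (\<exists>u v w. Y = {u, v, w} \<and> p u \<noteq> p v \<and> p u \<noteq> p w \<and> p v \<noteq> p w)"
proof -
  from assms obtain u v w where Y: "Y = {u, v, w}" "u \<noteq> v" "u \<noteq> w" "v \<noteq> w"
    by (auto simp: card_3_iff)
  show ?thesis
  proof (cases "p u \<noteq> p v \<and> p u \<noteq> p w \<and> p v \<noteq> p w")
    case True
    then have "p w \<noteq> p v" "p w \<noteq> p u" "p v \<noteq> p u" by metis+
    then have "ecount p Y = 3" using Y by simp
    then show ?thesis using True Y by blast
  next
    case False
    then show ?thesis using Y by auto
  qed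
qed

text \<open>Two vertices of \<open>Y\<close>, the triple with more edges, are added to
  \<open>X\<close>. This can fail only if \<open>Y\<close> and \<open>Z\<close> are triangles and
  \<open>X\<close> has one vertex in each class of \<open>Y\<close>; then a vertex of
  \<open>Z\<close> in a new class helps, and without one all three triples meet the same three
  classes.\<close>

lemma extend_triple_triple_aux:
  assumes fin: "finite V" and sub: "X \<subseteq> V" "Y \<subseteq> V" "Z \<subseteq> V"
    and disj: "X \<inter> Y = {}" "X \<inter> Z = {}" "Y \<inter> Z = {}"
    and card: "card Y = 3" "card Z = 3" "3 \<le> card X"
    and le: "ecount p Z \<le> ecount p Y"
  shows "(\<exists>T\<subseteq>V. card T = card X + 2 \<and> ecount p X + ecount p Y + ecount p Z \<le> ecount p T) \<or>
    (\<exists>I. card I = 3 \<and> bij_betw p X I \<and> bij_betw p Y I \<and> bij_betw p Z I)"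
proof -
  have finX: "finite X" using fin sub finite_subset by blast
  \<comment> \<open>The final summand of the condition is the possible edge between the two added
    vertices.\<close>
  have grow: ?thesis
    if "y \<in> V" "y \<notin> X" "z \<in> V" "z \<notin> X" "y \<noteq> z"
      "ecount p Y + ecount p Z \<le> deg_into p X y + deg_into p X z + (if p y \<noteq> p z then 1 else 0)" for y z
  proof -
    have "insert y (insert z X) \<subseteq> V \<and> card (insert y (insert z X)) = card X + 2 \<and>
        ecount p X + ecount p Y + ecount p Z \<le> ecount p (insert y (insert z X))"
      using that sub finX by (auto split: if_splits)
    then show ?thesis by blast
  qed
  have Z3: "ecount p Z \<le> 3" using card_3_ecount[OF card(2), of p] by auto
  consider "ecount p Y = 0"
    | u v where "ecount p Y = 2" "u \<in> Y" "v \<in> Y" "p u \<noteq> p v"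
    | u v w where "ecount p Y = 3" "Y = {u, v, w}" "p u \<noteq> p v" "p u \<noteq> p w" "p v \<noteq> p w"
    using card_3_ecount[OF card(1), of p] by metis
  then show ?thesis
  proof cases
    case 1
    from card(1) obtain u v where "u \<in> Y" "v \<in> Y" "u \<noteq> v" by (auto simp: card_3_iff)
    then show ?thesis using 1 le sub disj by (intro grow[of u v]) auto
  next
    case 2
    have "ecount p Z \<le> 2" using 2 le by simp
    moreover have "3 \<le> deg_into p X u + deg_into p X v" using deg_into_two[OF finX 2(4)] card by simp
    moreover have "u \<in> V" "v \<in> V" "u \<notin> X" "v \<notin> X" "u \<noteq> v" using 2 sub disj by auto
    ultimately show ?thesis using 2 by (intro grow[of u v]) simp_all
  next
    case 3
    have sum: "2 * card X \<le> deg_into p X u + deg_into p X v + deg_into p X w"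
      using deg_into_three finX 3 by metis
    have in': "u \<in> V" "v \<in> V" "w \<in> V" "u \<notin> X" "v \<notin> X" "w \<notin> X" using 3 sub disj by auto
    show ?thesis
    \<comment> \<open>Two vertices of the triangle \<open>Y\<close> contribute their degrees plus 1,
      to be compared with \<open>3 + ecount p Z\<close>; a degree sum of
      \<open>ecount p Z + 2\<close> is enough. Some pair always reaches 4, as the three degrees sum
      to at least 6, so 5 is needed only if \<open>Z\<close> is a triangle.\<close>
    proof (cases "5 \<le> deg_into p X u + deg_into p X v \<or> 5 \<le> deg_into p X u + deg_into p X w \<or> 5 \<le> deg_into p X v + deg_into p X w \<or>
        ecount p Z < 3")
      case True
      then have "ecount p Z + 2 \<le> deg_into p X u + deg_into p X v \<or> ecount p Z + 2 \<le> deg_into p X u + deg_into p X w \<or>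
          ecount p Z + 2 \<le> deg_into p X v + deg_into p X w"
        using sum card Z3 by linarith
      then show ?thesis
      proof (elim disjE)
        assume "ecount p Z + 2 \<le> deg_into p X u + deg_into p X v"
        then show ?thesis using 3 in' by (intro grow[of u v]) auto
      next
        assume "ecount p Z + 2 \<le> deg_into p X u + deg_into p X w"
        then show ?thesis using 3 in' by (intro grow[of u w]) auto
      next
        assume "ecount p Z + 2 \<le> deg_into p X v + deg_into p X w"
        then show ?thesis using 3 in' by (intro grow[of v w]) auto
      qed
    next
      case False
      have cX: "card X = 3" and d: "deg_into p X u = 2" "deg_into p X v = 2" "deg_into p X w = 2"
        using sum card False by linarith+
      have "ecount p Z = 3" using False Z3 by auto
      then obtain a b c where Z: "Z = {a, b, c}" "p a \<noteq> p b" "p a \<noteq> p c" "p b \<noteq> p c"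
        using card_3_ecount[OF card(2), of p] by auto
      define I where "I = {p u, p v, p w}"
      have cI: "card I = 3" using 3 by (simp add: I_def)
      \<comment> \<open>Degree 2 into a set of three vertices leaves one vertex of \<open>X\<close>
        in the class of \<open>y\<close>.\<close>
      have hit: "p y \<in> p ` X" if "deg_into p X y = 2" for y
      proof -
        have "card {x \<in> X. p x = p y} \<noteq> 0" using that card_class_plus_deg_into[OF finX, of p y] cX by simp
        then obtain x where "x \<in> X" "p x = p y" by (metis (mono_tags, lifting) card.empty empty_Collect_eq)
        then show ?thesis by (metis imageI)
      qed
      have "I \<subseteq> p ` X" using hit d by (simp add: I_def)
      moreover have "card (p ` X) \<le> 3" using card_image_le[OF finX, of p] cX by simp
      ultimately have imX: "p ` X = I" using cI finX card_seteq[of "p ` X" I] by simp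
      \<comment> \<open>Such a \<open>z\<close> is adjacent to all of \<open>X\<close> and to
        \<open>u\<close>; adding both gains 2 + 3 + 1 = 6 edges, as many as the two triangles
        have.\<close>
      have out: ?thesis if "z \<in> Z" "p z \<notin> I" for z
      proof -
        have "p x \<noteq> p z" if "x \<in> X" for x using that \<open>p z \<notin> I\<close> imX by (metis imageI)
        then have "{x \<in> X. p x \<noteq> p z} = X" by auto
        then have "deg_into p X z = 3" using cX by (simp add: deg_into_def)
        moreover have "p u \<noteq> p z" using that by (auto simp: I_def)
        moreover have "z \<in> V" "z \<notin> X" "u \<noteq> z" using that sub disj by (auto simp: I_def)
        ultimately show ?thesis using in' d(1) 3(1) Z3 by (intro grow[of u z]) simp_all
      qed
      show ?thesis
      proof (cases "p ` Z \<subseteq> I")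
        case False
        then show ?thesis using out by blast
      next
        case True
        moreover have "card (p ` Z) = 3" using Z by simp
        moreover have "finite I" by (simp add: I_def)
        ultimately have imZ: "p ` Z = I" using cI card_subset_eq[of I "p ` Z"] by simp
        have imY: "p ` Y = I" using 3 by (simp add: I_def)
        have "finite Y" "finite Z" using fin sub finite_subset by blast+
        then have "inj_on p X" "inj_on p Y" "inj_on p Z"
          using cX card cI imX imY imZ finX by (simp_all add: eq_card_imp_inj_on)
        then show ?thesis using imX imY imZ cI by (auto simp: bij_betw_def)
      qed
    qed
  qed
qed

lemma extend_triple_triple:
  assumes fin: "finite V" and sub: "X \<subseteq> V" "Y \<subseteq> V" "Z \<subseteq> V"
    and disj: "X \<inter> Y = {}" "X \<inter> Z = {}" "Y \<inter> Z = {}"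
    and card: "card Y = 3" "card Z = 3" "3 \<le> card X"
  shows "(\<exists>T\<subseteq>V. card T = card X + 2 \<and> ecount p X + ecount p Y + ecount p Z \<le> ecount p T) \<or>
    (\<exists>I. card I = 3 \<and> bij_betw p X I \<and> bij_betw p Y I \<and> bij_betw p Z I)"
proof (cases "ecount p Z \<le> ecount p Y")
  case True
  then show ?thesis using extend_triple_triple_aux[OF assms] by blast
next
  case False
  have eq: "ecount p X + ecount p Y + ecount p Z = ecount p X + ecount p Z + ecount p Y" by simp
  have "Z \<inter> Y = {}" "ecount p Y \<le> ecount p Z" using disj(3) False by auto
  from extend_triple_triple_aux[OF fin sub(1,3,2) disj(2,1) this(1) card(2,1,3) this(2)]
  show ?thesis
  proof (elim disjE)
    assume "\<exists>I. card I = 3 \<and> bij_betw p X I \<and> bij_betw p Z I \<and> bij_betw p Y I"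
    then show ?thesis by (intro disjI2) blast
  qed (unfold eq, rule disjI1)
qed

subsection \<open>Components and their orders\<close>

lemma complete_multipartite_cross_edges:
  fixes G :: "'a ugraph"
  assumes "complete_multipartite ps G"
  obtains p :: "'a \<Rightarrow> nat" where "edges G = cross_edges p (verts G)"
    and "card (verts G) = sum_list ps"
proof -
  from assms obtain A :: "nat \<Rightarrow> 'a set" where
    A: "(\<forall>i<length ps. finite (A i) \<and> card (A i) = ps ! i) \<and> disjoint_family_on A {..<length ps} \<and>
      verts G = (\<Union>i<length ps. A i) \<and>
      edges G = {{u, v} | u v i j. i < length ps \<and> j < length ps \<and> i \<noteq> j \<and> u \<in> A i \<and> v \<in> A j}"
    unfolding complete_multipartite_def by (rule exE)
  have fin: "\<And>i. i < length ps \<Longrightarrow> finite (A i)" and card: "\<And>i. i < length ps \<Longrightarrow> card (A i) = ps ! i"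
    and disj: "disjoint_family_on A {..<length ps}" and V: "verts G = (\<Union>i<length ps. A i)"
    using A by simp_all
  have E: "edges G = {{u, v} | u v i j. i < length ps \<and> j < length ps \<and> i \<noteq> j \<and> u \<in> A i \<and> v \<in> A j}"
    using A by (elim conjE)
  \<comment> \<open>The parts are disjoint, so on vertices the chosen index is the only possible
    one.\<close>
  define p where "p v = (SOME i. i < length ps \<and> v \<in> A i)" for v
  have p: "p v = i" if "i < length ps" "v \<in> A i" for i v
  proof -
    have "p v < length ps \<and> v \<in> A (p v)"
      unfolding p_def by (rule someI[of _ i]) (simp add: that)
    then show ?thesis using that disjoint_family_onD[OF disj, of "p v" i] by auto
  qed
  have "edges G = cross_edges p (verts G)"
  proof (intro set_eqI iffI)
    fix e assume "e \<in> edges G"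
    then obtain u v i j where "e = {u, v}" "i < length ps" "j < length ps" "i \<noteq> j" "u \<in> A i" "v \<in> A j"
      unfolding E by blast
    moreover from this have "p u \<noteq> p v" using p by auto
    ultimately show "e \<in> cross_edges p (verts G)" unfolding cross_edges_def V by blast
  next
    fix e assume "e \<in> cross_edges p (verts G)"
    then obtain u v i j where "e = {u, v}" "i < length ps" "j < length ps" "p u \<noteq> p v" "u \<in> A i" "v \<in> A j"
      unfolding cross_edges_def V by blast
    moreover from this have "i \<noteq> j" using p by auto
    ultimately show "e \<in> edges G" unfolding E by blast
  qed
  moreover have "card (verts G) = (\<Sum>i<length ps. card (A i))"
    unfolding V using fin disj
    by (intro card_UN_disjoint) (auto simp: disjoint_family_on_def)
  then have "card (verts G) = sum_list ps"
    using card by (simp add: sum_list_sum_nth atLeast0LessThan)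
  ultimately show ?thesis using that by blast
qed

text \<open>The way back from classes to partite sets, by which an exceptional \<open>p\<close> is
  recognised as one of the excluded graphs. The list \<open>cs\<close> fixes the order in which the
  sizes are read off.\<close>

lemma complete_multipartite_classes:
  assumes "finite (verts G)" "edges G = cross_edges p (verts G)" "distinct cs" "p ` verts G \<subseteq> set cs"
  shows "complete_multipartite (map (\<lambda>c. card {v \<in> verts G. p v = c}) cs) G"
proof -
  define A where "A i = {v \<in> verts G. p v = cs ! i}" for i
  have V: "verts G = (\<Union>i<length cs. A i)"
  proof (intro equalityI subsetI)
    fix v assume v: "v \<in> verts G"
    then have "p v \<in> set cs" using assms(4) by auto
    then obtain i where "i < length cs" "cs ! i = p v" by (auto simp: in_set_conv_nth)
    with v have "v \<in> A i" "i \<in> {..<length cs}" by (auto simp: A_def)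
    then show "v \<in> (\<Union>i<length cs. A i)" by blast
  qed (auto simp: A_def)
  have E: "edges G = {{u, v} | u v i j. i < length cs \<and> j < length cs \<and> i \<noteq> j \<and> u \<in> A i \<and> v \<in> A j}"
    (is "_ = ?R")
  proof (intro set_eqI iffI)
    fix e assume "e \<in> edges G"
    then obtain u v where e: "e = {u, v}" "u \<in> verts G" "v \<in> verts G" "p u \<noteq> p v"
      using assms(2) by (auto simp: cross_edges_def)
    then obtain i j where "i < length cs" "j < length cs" "u \<in> A i" "v \<in> A j" unfolding V by blast
    moreover from this e have "i \<noteq> j" by (auto simp: A_def)
    ultimately show "e \<in> ?R" using e by blast
  next
    fix e assume "e \<in> ?R"
    then obtain u v i j where "e = {u, v}" "i < length cs" "j < length cs" "i \<noteq> j" "u \<in> A i" "v \<in> A j"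
      by blast
    then show "e \<in> edges G" using assms(2,3) by (simp add: A_def nth_eq_iff_index_eq)
  qed
  have "disjoint_family_on A {..<length cs}"
    using assms(3) by (auto simp: disjoint_family_on_def A_def nth_eq_iff_index_eq)
  moreover have "\<forall>i<length cs. finite (A i) \<and> card (A i) = map (\<lambda>c. card {v \<in> verts G. p v = c}) cs ! i"
    using assms(1) by (auto simp: A_def)
  ultimately show ?thesis
    unfolding complete_multipartite_def using V E by (intro exI[of _ A]) simp
qed

section \<open>Reachability and the partition into components\<close>

lemma reachable_refl [simp]: "reachable G u u"
  by (simp add: reachable_def)

lemma reachable_sym: "reachable G u v \<Longrightarrow> reachable G v u"
proof -
  have "sym ({(x, y). {x, y} \<in> edges G}\<^sup>*)"
    by (intro sym_rtrancl) (auto simp: sym_def insert_commute)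
  then show "reachable G u v \<Longrightarrow> reachable G v u" by (auto simp: reachable_def sym_def)
qed

lemma reachable_trans: "reachable G u v \<Longrightarrow> reachable G v w \<Longrightarrow> reachable G u w"
  by (auto simp: reachable_def)

lemma partition_on_components: "partition_on (verts G) (components G)"
proof (rule partition_onI)
  show "\<Union> (components G) = verts G"
  proof (intro equalityI subsetI)
    fix v assume "v \<in> verts G"
    then have "v \<in> {w \<in> verts G. reachable G v w}" "{w \<in> verts G. reachable G v w} \<in> components G"
      by (auto simp: components_def)
    then show "v \<in> \<Union> (components G)" by blast
  qed (auto simp: components_def)
next
  fix C C' assume "C \<in> components G" "C' \<in> components G" "C \<noteq> C'"
  then obtain u u' where u: "C = {v \<in> verts G. reachable G u v}" "C' = {v \<in> verts G. reachable G u' v}"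
    by (auto simp: components_def)
  show "disjnt C C'"
  proof (rule ccontr)
    assume "\<not> disjnt C C'"
    then obtain w where "reachable G u w" "reachable G u' w" using u by (auto simp: disjnt_def)
    then have "reachable G u v = reachable G u' v" for v
      by (meson reachable_sym reachable_trans)
    with u \<open>C \<noteq> C'\<close> show False by auto
  qed
qed (auto simp: components_def)

lemma connected_graph_components:
  assumes "finite (verts G)" "verts G \<noteq> {}"
  shows "connected_graph G \<longleftrightarrow> card (components G) \<le> 1"
proof
  assume "connected_graph G"
  then have "components G \<subseteq> {verts G}"
    by (auto simp: components_def connected_graph_def)
  then show "card (components G) \<le> 1" using card_mono[of "{verts G}"] by simp
next
  assume *: "card (components G) \<le> 1"
  have fin: "finite (components G)"
    using assms(1) partition_on_components finite_elements by blast
  show "connected_graph G"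
    unfolding connected_graph_def
  proof (intro ballI)
    fix u v assume uv: "u \<in> verts G" "v \<in> verts G"
    have eq: "C = C'" if "C \<in> components G" "C' \<in> components G" for C C'
      using * fin that by (simp add: card_le_Suc0_iff_eq)
    have "{w \<in> verts G. reachable G u w} \<in> components G" "{w \<in> verts G. reachable G v w} \<in> components G"
      using uv by (auto simp: components_def)
    then have "{w \<in> verts G. reachable G u w} = {w \<in> verts G. reachable G v w}" by (rule eq)
    moreover have "v \<in> {w \<in> verts G. reachable G v w}" using uv by simp
    ultimately have "v \<in> {w \<in> verts G. reachable G u w}" by (simp only:)
    then show "reachable G u v" by simp
  qed
qed

text \<open>Distinct components may have equal orders, so the list of orders is realised through a
  list of the components themselves, sorted by size.\<close>

lemma comp_orders_conv:
  assumes "finite (components G)"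
  obtains Cs where "distinct Cs" "set Cs = components G" "comp_orders G = map card Cs"
    "sorted_wrt (\<ge>) (map card Cs)"
proof -
  obtain xs where xs: "set xs = components G" "distinct xs"
    using assms finite_distinct_list by blast
  define Cs where "Cs = rev (sort_key card xs)"
  have "image_mset card (mset_set (components G)) = mset (map card xs)"
    using xs by (metis mset_map mset_set_set)
  then have "sorted_list_of_multiset (image_mset card (mset_set (components G))) = map card (sort_key card xs)"
    by (metis mset_map mset_sort properties_for_sort sorted_list_of_multiset_mset sorted_sort_key)
  then have "comp_orders G = map card Cs" by (simp add: comp_orders_def Cs_def rev_map)
  moreover have "sorted_wrt (\<ge>) (map card Cs)"
    by (simp add: Cs_def rev_map[symmetric] sorted_wrt_rev)
  ultimately show ?thesis using xs that[of Cs] by (simp add: Cs_def)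
qed

text \<open>The first two entries of a non-increasing list dominate the entries at any two different
  positions. This replaces sorted lists by a condition on pairs of blocks, the form in which the
  partition argument uses it.\<close>

lemma comp_order_le_iff:
  assumes "finite (components G)" "2 \<le> card (components G)"
  shows "comp_order 1 G + comp_order 2 G \<le> q \<longleftrightarrow>
    (\<forall>C\<in>components G. \<forall>C'\<in>components G. C \<noteq> C' \<longrightarrow> card C + card C' \<le> q)"
proof -
  obtain Cs where Cs: "distinct Cs" "set Cs = components G" "comp_orders G = map card Cs"
      "sorted_wrt (\<ge>) (map card Cs)" using comp_orders_conv assms(1) by metis
  have "2 \<le> length Cs" using assms(2) Cs distinct_card by metis
  then have len: "0 < length Cs" "1 < length Cs" by linarith+
  have ord: "comp_order 1 G = card (Cs ! 0)" "comp_order 2 G = card (Cs ! 1)"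
    using len nth_map[of 0 Cs card] nth_map[of 1 Cs card] by (simp_all add: comp_order_def Cs(3))
  have mono: "card (Cs ! j) \<le> card (Cs ! i)" if "i \<le> j" "j < length Cs" for i j
    using Cs(4) that by (cases "i = j") (auto simp: sorted_wrt_iff_nth_less)
  show ?thesis
  proof
    assume le: "comp_order 1 G + comp_order 2 G \<le> q"
    \<comment> \<open>From \<open>i < j\<close> follow \<open>0 \<le> i\<close> and
      \<open>1 \<le> j\<close>, so the two leading entries bound these two.\<close>
    have lt: "card (Cs ! i) + card (Cs ! j) \<le> q" if "i < j" "j < length Cs" for i j
      using le ord mono[of 0 i] mono[of 1 j] that by linarith
    show "\<forall>C\<in>components G. \<forall>C'\<in>components G. C \<noteq> C' \<longrightarrow> card C + card C' \<le> q"
    proof (intro ballI impI)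
      fix C C' assume "C \<in> components G" "C' \<in> components G" "C \<noteq> C'"
      then obtain i j where "C = Cs ! i" "C' = Cs ! j" "i < length Cs" "j < length Cs" "i \<noteq> j"
        by (metis Cs(2) in_set_conv_nth)
      then show "card C + card C' \<le> q" using lt[of i j] lt[of j i] by (cases i j rule: linorder_cases) auto
    qed
  next
    assume *: "\<forall>C\<in>components G. \<forall>C'\<in>components G. C \<noteq> C' \<longrightarrow> card C + card C' \<le> q"
    have "Cs ! 0 \<noteq> Cs ! 1" "Cs ! 0 \<in> components G" "Cs ! 1 \<in> components G"
      using len Cs(1,2) nth_mem[of 0 Cs] nth_mem[of 1 Cs] by (auto simp: nth_eq_iff_index_eq)
    with * ord show "comp_order 1 G + comp_order 2 G \<le> q" by simp
  qed
qed

text \<open>Both ends of an edge lie in the same component, and \<open>p\<close> allows at most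
  \<open>ecount p C\<close> edges inside \<open>C\<close>.\<close>

lemma card_edges_le_components:
  assumes "finite (verts H)" "edges H \<subseteq> cross_edges p (verts H)"
  shows "card (edges H) \<le> (\<Sum>C\<in>components H. ecount p C)"
proof -
  have fin: "finite (components H)" "\<And>C. C \<in> components H \<Longrightarrow> finite C"
    using assms(1) partition_on_components finite_elements
    by (blast, auto simp: components_def)
  have "edges H \<subseteq> (\<Union>C\<in>components H. cross_edges p C)"
  proof
    fix e assume e: "e \<in> edges H"
    then obtain u v where uv: "e = {u, v}" "u \<in> verts H" "v \<in> verts H" "p u \<noteq> p v"
      using assms(2) by (fastforce simp: cross_edges_def)
    have "reachable H u v" using e uv by (auto simp: reachable_def)
    then have "e \<in> cross_edges p {w \<in> verts H. reachable H u w}"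
      using uv by simp
    moreover have "{w \<in> verts H. reachable H u w} \<in> components H"
      using uv(2) by (auto simp: components_def)
    ultimately show "e \<in> (\<Union>C\<in>components H. cross_edges p C)" by blast
  qed
  then have "card (edges H) \<le> card (\<Union>C\<in>components H. cross_edges p C)"
    using fin by (intro card_mono) (auto intro: finite_cross_edges)
  also have "\<dots> \<le> (\<Sum>C\<in>components H. ecount p C)"
    unfolding ecount_def using fin(1) by (rule card_UN_le)
  finally show ?thesis .
qed

text \<open>An edge either meets \<open>S\<close> or has both ends in the complement. Minimising the
  incident edges over sets of size \<open>n - q + 1\<close> therefore means maximising
  \<open>ecount\<close> over sets of size \<open>q - 1\<close>.\<close>

lemma ecount_plus_incident:
  assumes "finite (verts G)" "edges G = cross_edges p (verts G)" "S \<subseteq> verts G"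
  shows "ecount p (verts G - S) + card (incident_edges G S) = card (edges G)"
    and "edges G - incident_edges G S = cross_edges p (verts G - S)"
proof -
  show eq: "edges G - incident_edges G S = cross_edges p (verts G - S)"
    (is "?L = ?R")
  proof (rule set_eqI)
    fix e
    show "e \<in> ?L \<longleftrightarrow> e \<in> ?R"
    proof (cases "\<exists>u v. e = {u, v}")
      case True
      then show ?thesis using assms by (auto simp: incident_edges_def)
    next
      case False
      then show ?thesis using assms by (auto simp: cross_edges_def)
    qed
  qed
  have "finite (edges G)" using assms finite_cross_edges by metis
  moreover have "incident_edges G S \<subseteq> edges G" by (auto simp: incident_edges_def)
  ultimately show "ecount p (verts G - S) + card (incident_edges G S) = card (edges G)"
    unfolding ecount_def eq[symmetric]
    by (metis card_Diff_subset card_mono finite_subset le_add_diff_inverse2)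
qed

subsection \<open>Partitions of the vertex set\<close>

lemma card_class_Un:
  assumes "finite A" "finite B" "A \<inter> B = {}"
  shows "card {v \<in> A \<union> B. p v = c} = card {v \<in> A. p v = c} + card {v \<in> B. p v = c}"
proof -
  have "{v \<in> A \<union> B. p v = c} = {v \<in> A. p v = c} \<union> {v \<in> B. p v = c}" by auto
  with assms show ?thesis by (simp add: card_Un_disjoint disjoint_iff)
qed

lemma card_class_pair:
  assumes "card Y = 2" "ecount p Y = 1" "p ` Y \<subseteq> {a, b}" "c \<in> {a, b}"
  shows "card {v \<in> Y. p v = c} = 1"
proof -
  obtain u v where Y: "Y = {u, v}" "p u \<noteq> p v"
    using card_2_ecount[OF assms(1), of p] assms(2) by (metis zero_neq_one)
  then have "{y \<in> Y. p y = c} = (if p u = c then {u} else {v})"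
    using assms(3,4) by auto
  then show ?thesis by simp
qed

lemma card_class_bij_betw:
  assumes "bij_betw p X I" "c \<in> I"
  shows "card {v \<in> X. p v = c} = 1"
proof -
  obtain x where "x \<in> X" "p x = c" using assms by (auto simp: bij_betw_def)
  then have "{v \<in> X. p v = c} = {x}" using assms(1) by (auto simp: bij_betw_def inj_on_def)
  then show ?thesis by simp
qed

text \<open>The three excluded pairs, read off the sizes of the fibres of \<open>p\<close>.\<close>

definition exceptional :: "('a \<Rightarrow> 'b) \<Rightarrow> 'a set \<Rightarrow> nat \<Rightarrow> bool" where
  "exceptional p V q \<longleftrightarrow> (\<exists>cs. distinct cs \<and> p ` V \<subseteq> set cs \<and>
    (map (\<lambda>c. card {v \<in> V. p v = c}) cs, q) \<in> {([3, 3], 4), ([4, 3], 4), ([3, 3, 3], 6)})"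

lemma exceptionalI2:
  assumes "a \<noteq> b" "p ` V \<subseteq> {a, b}" "card {v \<in> V. p v = a} \<in> {3, 4}" "card {v \<in> V. p v = b} = 3" "q = 4"
  shows "exceptional p V q"
  unfolding exceptional_def using assms by (intro exI[of _ "[a, b]"]) auto

text \<open>With only two classes present, each of the three pairs has one vertex in either class,
  so the classes have three vertices each; a vertex in \<open>W\<close> raises one of them to four.
  This yields the sizes 3, 3 and 4, 3.\<close>

lemma exceptional_pairs:
  assumes fin: "finite X" "finite Y" "finite Z"
    and disj: "X \<inter> Y = {}" "X \<inter> Z = {}" "Y \<inter> Z = {}" "W \<inter> (X \<union> Y \<union> Z) = {}"
    and card: "card X = 2" "card Y = 2" "card Z = 2"
    and e: "ecount p X = 1" "ecount p Y = 1" "ecount p Z = 1"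
    and V: "V = X \<union> Y \<union> Z \<union> W"
    and bip: "\<forall>u\<in>V. \<forall>v\<in>V. \<forall>w\<in>V. p u = p v \<or> p u = p w \<or> p v = p w"
    and W: "W = {} \<or> (\<exists>w. W = {w})" and q: "q = 4"
  shows "exceptional p V q"
proof -
  obtain u v where uv: "X = {u, v}" "p u \<noteq> p v"
    using card_2_ecount[OF card(1), of p] e(1) by (metis zero_neq_one)
  have uvV: "u \<in> V" "v \<in> V" using uv V by auto
  have bip': "p x = p u \<or> p x = p v" if "x \<in> V" for x
    using bip[rule_format, OF uvV that] uv(2) by metis
  \<comment> \<open>The two classes are named so that \<open>a\<close> is the one containing the
    vertex of \<open>W\<close>, if there is one.\<close>
  have "\<exists>a b. a \<noteq> b \<and> {a, b} = {p u, p v} \<and> p ` W \<subseteq> {a}"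
  proof (cases "W = {}")
    case True
    then show ?thesis using uv by blast
  next
    case False
    then obtain w where "W = {w}" using W by blast
    then have "w \<in> V" using V by simp
    from bip'[OF this] show ?thesis
    proof
      assume "p w = p u"
      then show ?thesis using \<open>W = {w}\<close> uv(2) by (intro exI[of _ "p u"] exI[of _ "p v"]) auto
    next
      assume "p w = p v"
      then show ?thesis using \<open>W = {w}\<close> uv(2) by (intro exI[of _ "p v"] exI[of _ "p u"]) auto
    qed
  qed
  then obtain a b where ab: "a \<noteq> b" "{a, b} = {p u, p v}" "p ` W \<subseteq> {a}" by blast
  have im: "p ` V \<subseteq> {a, b}"
    unfolding ab(2) using bip' by auto
  have sub: "p ` X \<subseteq> {a, b}" "p ` Y \<subseteq> {a, b}" "p ` Z \<subseteq> {a, b}" using im V by auto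
  have finW: "finite W" using W by auto
  have cnt: "card {x \<in> V. p x = c} = 3 + card {x \<in> W. p x = c}" if c: "c \<in> {a, b}" for c
  proof -
    have "card {x \<in> V. p x = c} = card {x \<in> X \<union> Y \<union> Z. p x = c} + card {x \<in> W. p x = c}"
      unfolding V using fin finW disj by (intro card_class_Un) auto
    also have "card {x \<in> X \<union> Y \<union> Z. p x = c} = card {x \<in> X \<union> Y. p x = c} + card {x \<in> Z. p x = c}"
      using fin disj by (intro card_class_Un) auto
    also have "card {x \<in> X \<union> Y. p x = c} = card {x \<in> X. p x = c} + card {x \<in> Y. p x = c}"
      using fin disj by (intro card_class_Un) auto
    finally show ?thesis
      using card_class_pair[OF card(1) e(1) sub(1) c] card_class_pair[OF card(2) e(2) sub(2) c]
        card_class_pair[OF card(3) e(3) sub(3) c] by simp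
  qed
  have "{x \<in> W. p x = b} = {}" using ab by auto
  then have cb: "card {x \<in> V. p x = b} = 3" using cnt[of b] by (simp only: card.empty) simp
  have "{x \<in> W. p x = a} = W" using ab by auto
  then have "card {x \<in> V. p x = a} = 3 + card W" using cnt[of a] by (simp only:) simp
  then have "card {x \<in> V. p x = a} \<in> {3, 4}" using W by auto
  then show ?thesis using exceptionalI2[OF ab(1) im _ cb q] by simp
qed

text \<open>Each triple contains exactly one vertex of each class in \<open>I\<close>, so there are
  three classes of size three.\<close>

lemma exceptional_triples:
  assumes fin: "finite X" "finite Y" "finite Z"
    and disj: "X \<inter> Y = {}" "X \<inter> Z = {}" "Y \<inter> Z = {}"
    and I: "card I = 3" "bij_betw p X I" "bij_betw p Y I" "bij_betw p Z I"
    and V: "V = X \<union> Y \<union> Z" and q: "q = 6"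
  shows "exceptional p V q"
proof -
  obtain a b c where abc: "I = {a, b, c}" "a \<noteq> b" "a \<noteq> c" "b \<noteq> c" using I(1) by (auto simp: card_3_iff)
  have "card {x \<in> V. p x = i} = 3" if i: "i \<in> I" for i
  proof -
    have "card {x \<in> V. p x = i} = card {x \<in> X \<union> Y. p x = i} + card {x \<in> Z. p x = i}"
      unfolding V using fin disj by (intro card_class_Un) auto
    also have "card {x \<in> X \<union> Y. p x = i} = card {x \<in> X. p x = i} + card {x \<in> Y. p x = i}"
      using fin disj by (intro card_class_Un) auto
    finally show ?thesis
      using card_class_bij_betw[OF I(2) i] card_class_bij_betw[OF I(3) i] card_class_bij_betw[OF I(4) i]
      by simp
  qed
  moreover have "p ` V \<subseteq> I" using I V by (auto simp: bij_betw_def)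
  ultimately show ?thesis
    unfolding exceptional_def using abc q by (intro exI[of _ "[a, b, c]"]) auto
qed

text \<open>The upper bound in partition form. Draining the smaller blocks to a total of
  \<open>m + 1\<close> vertices leaves exactly \<open>q - 1\<close> in the big one. Where the
  drained blocks keep one or two vertices more, the extension lemmas supply that many new
  vertices.\<close>

lemma partition_ecount_bound:
  assumes fin: "finite V" and part: "partition_on V P"
    and two: "2 \<le> card P" and sums: "\<And>C C'. C \<in> P \<Longrightarrow> C' \<in> P \<Longrightarrow> C \<noteq> C' \<Longrightarrow> card C + card C' \<le> q"
    and q: "card V - 3 \<le> q" "q \<le> card V - 1" "2 \<le> q" and exc: "\<not> exceptional p V q"
  shows "\<exists>T\<subseteq>V. card T = q - 1 \<and> (\<Sum>C\<in>P. ecount p C) \<le> ecount p T"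
proof -
  define m where "m = card V - q"
  have m: "card V = q + m" "1 \<le> m" "m \<le> 3" using q by (auto simp: m_def)
  have finP: "finite P" using finite_elements[OF fin part] .
  have finC: "finite C" if "C \<in> P" for C
    using that part fin by (auto simp: partition_on_def intro: finite_subset)
  have pos: "1 \<le> card C" if "C \<in> P" for C
    using that part finC by (auto simp: partition_on_def Suc_le_eq card_gt_0_iff)
  have "P \<noteq> {}" using two by auto
  then have "Max (card ` P) \<in> card ` P" using finP by simp
  then obtain X where X: "X \<in> P" "Max (card ` P) = card X" by blast
  have maxX: "card C \<le> card X" if "C \<in> P" for C
    unfolding X(2)[symmetric] using that finP by simp
  note X = X(1)
  define D where "D = P - {X}"
  have finD: "finite D" using finP by (simp add: D_def)
  have cD: "card P = Suc (card D)" using card.remove[OF finP X] by (simp add: D_def)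
  have VX: "V = X \<union> \<Union>D" using part X by (auto simp: partition_on_def D_def)
  have disjD: "disjoint_family_on (\<lambda>C. C) D"
    using part by (auto simp: partition_on_def disjoint_def D_def disjoint_family_on_def)
  have disjX: "X \<inter> C = {}" if "C \<in> D" for C
    using that part X by (auto simp: partition_on_def disjoint_def D_def)
  have sumD: "card V = card X + (\<Sum>C\<in>D. card C)"
    using sum.remove[OF finP X, of card] product_partition[OF part] finC by (simp add: D_def)
  have sumE: "(\<Sum>C\<in>P. ecount p C) = ecount p X + (\<Sum>C\<in>D. ecount p C)"
    using sum.remove[OF finP X, of "ecount p"] by (simp add: D_def)
  \<comment> \<open>The largest block absorbs vertices from all others; the choice of
    \<open>t\<close> alone determines the final size of \<open>X'\<close>.\<close>
  have drained: "\<exists>X' F'. X' \<union> (\<Union>C\<in>D. F' C) = V \<and> disjoint_family_on F' D \<and>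
      (\<forall>C\<in>D. X' \<inter> F' C = {} \<and> card (F' C) = t C) \<and> card X \<le> card X' \<and> finite X' \<and>
      (\<forall>C\<in>D. finite (F' C)) \<and> card V = card X' + (\<Sum>C\<in>D. t C) \<and>
      (\<Sum>C\<in>P. ecount p C) \<le> ecount p X' + (\<Sum>C\<in>D. ecount p (F' C))"
    if t: "\<And>C. C \<in> D \<Longrightarrow> t C \<le> card C" for t
  proof -
    have "\<exists>X' F'. X' \<union> (\<Union>C\<in>D. F' C) = X \<union> (\<Union>C\<in>D. C) \<and> disjoint_family_on F' D \<and>
      (\<forall>C\<in>D. X' \<inter> F' C = {} \<and> card (F' C) = t C) \<and> card X \<le> card X' \<and>
      ecount p X + (\<Sum>C\<in>D. ecount p C) \<le> ecount p X' + (\<Sum>C\<in>D. ecount p (F' C))"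
      using finD X finC disjD disjX t maxX by (intro drain_family) (auto simp: D_def)
    then obtain X' F' where *: "X' \<union> (\<Union>C\<in>D. F' C) = V" "disjoint_family_on F' D"
      "\<forall>C\<in>D. X' \<inter> F' C = {} \<and> card (F' C) = t C" "card X \<le> card X'"
      "(\<Sum>C\<in>P. ecount p C) \<le> ecount p X' + (\<Sum>C\<in>D. ecount p (F' C))"
      unfolding sumE VX by auto
    have finU: "finite X'" "\<forall>C\<in>D. finite (F' C)" using *(1) fin by (auto intro: finite_subset)
    have "card V = card X' + card (\<Union>C\<in>D. F' C)"
      unfolding *(1)[symmetric] using finU finD *(3) by (intro card_Un_disjoint) auto
    also have "card (\<Union>C\<in>D. F' C) = (\<Sum>C\<in>D. t C)"
      using finU finD *(2,3) by (subst card_UN_disjoint) (auto simp: disjoint_family_on_def)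
    finally show ?thesis using * finU by blast
  qed
  have sumt: "(\<Sum>C\<in>D. t C) = m + 1 \<Longrightarrow> card V = x + (\<Sum>C\<in>D. t C) \<Longrightarrow> x = q - 1" for t x
    using m q by simp
  \<comment> \<open>Two blocks alone would contain all \<open>q + m > q\<close> vertices.\<close>
  have D1: "card D \<noteq> 1"
  proof
    assume "card D = 1"
    then obtain Y where "D = {Y}" by (auto simp: card_1_singleton_iff)
    moreover from this have "Y \<in> P" "Y \<noteq> X" by (auto simp: D_def)
    ultimately show False using sums[of X Y] X sumD m by simp
  qed
  \<comment> \<open>\<open>X\<close> and \<open>Y\<close> together have at most \<open>q\<close>
    vertices, so at least \<open>n - q\<close> lie in the remaining blocks.\<close>
  have rest: "m \<le> (\<Sum>C\<in>D - {Y}. card C)" if "Y \<in> D" for Y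
  proof -
    have "card X + card Y \<le> q" using that X by (intro sums) (auto simp: D_def)
    then show ?thesis using sum.remove[OF finD that, of card] sumD m by simp
  qed
  \<comment> \<open>Since \<open>2 \<le> card D\<close> and \<open>m \<le> 3\<close>, only three
    combinations have \<open>card D \<le> m\<close>.\<close>
  consider "m + 1 \<le> card D" | "card D = 2" "m = 2" | "card D = 2" "m = 3" | "card D = 3" "m = 3"
    using D1 two cD m by linarith
  then show ?thesis
  proof cases
    case 1
    then obtain D0 where D0: "D0 \<subseteq> D" "card D0 = m + 1" by (metis obtain_subset_with_card_n)
    \<comment> \<open>Exactly \<open>m + 1\<close> blocks keep one vertex and the others are
      emptied, so no edge remains outside \<open>X'\<close>.\<close>
    define t :: "'a set \<Rightarrow> nat" where "t C = (if C \<in> D0 then 1 else 0)" for C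
    have t: "t C \<le> 1" "C \<in> D \<Longrightarrow> t C \<le> card C" for C
      using pos[of C] by (auto simp: t_def D_def)
    have "(\<Sum>C\<in>D. t C) = card D0"
      using D0(1) finD by (simp add: t_def sum.If_cases Int_absorb1)
    with drained[of t] t(2) D0(2) obtain X' F' where *: "X' \<union> (\<Union>C\<in>D. F' C) = V"
      "\<forall>C\<in>D. finite (F' C)" "\<forall>C\<in>D. card (F' C) = t C" "card X' = q - 1"
      "(\<Sum>C\<in>P. ecount p C) \<le> ecount p X' + (\<Sum>C\<in>D. ecount p (F' C))"
      using sumt by metis
    have "(\<Sum>C\<in>D. ecount p (F' C)) = 0" using * t(1) by (intro sum.neutral) (auto intro: ecount_le_1)
    with * show ?thesis by (intro exI[of _ X']) auto
  next
    case 2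
    then obtain Y Z where D: "D = {Y, Z}" "Y \<noteq> Z" by (auto simp: card_2_iff)
    \<comment> \<open>With only two smaller blocks, \<open>rest\<close> applied to one bounds the
      size of the other.\<close>
    have "2 \<le> card Y" "2 \<le> card Z" using rest[of Y] rest[of Z] D 2 by (auto simp: insert_Diff_if)
    moreover have "Y \<in> P" using D by (auto simp: D_def)
    ultimately have "\<And>C. C \<in> D \<Longrightarrow> 2 \<le> card C" "2 \<le> card X" using D maxX[of Y] by auto
    with drained[of "\<lambda>_. 2"] obtain X' F' where *: "X' \<union> (\<Union>C\<in>D. F' C) = V"
      "disjoint_family_on F' D" "\<forall>C\<in>D. X' \<inter> F' C = {} \<and> card (F' C) = 2" "card X \<le> card X'" "finite X'"
      "\<forall>C\<in>D. finite (F' C)" "card V = card X' + (\<Sum>C\<in>D. 2)"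
      "(\<Sum>C\<in>P. ecount p C) \<le> ecount p X' + (\<Sum>C\<in>D. ecount p (F' C))" by blast
    have Y: "V = X' \<union> F' Y \<union> F' Z" "F' Y \<inter> F' Z = {}" "X' \<inter> F' Y = {}" "X' \<inter> F' Z = {}"
      "card (F' Y) = 2" "card (F' Z) = 2" "finite (F' Y)" "finite (F' Z)" "card X' + 1 = q - 1"
      "(\<Sum>C\<in>P. ecount p C) \<le> ecount p X' + ecount p (F' Y) + ecount p (F' Z)"
      using * D m 2 by (auto simp: disjoint_family_on_def)
    have "2 \<le> card X'" using * \<open>2 \<le> card X\<close> by simp
    with extend_pair_pair[of V X' "F' Y" "F' Z" p] Y fin
    consider T where "T \<subseteq> V" "card T = card X' + 1" "ecount p X' + ecount p (F' Y) + ecount p (F' Z) \<le> ecount p T"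
      | "card X' = 2" "ecount p X' = 1" "ecount p (F' Y) = 1" "ecount p (F' Z) = 1"
        "\<forall>u\<in>V. \<forall>v\<in>V. \<forall>w\<in>V. p u = p v \<or> p u = p w \<or> p v = p w"
      by auto
    then show ?thesis
    proof cases
      case 1
      then show ?thesis using Y by (intro exI[of _ T]) auto
    next
      case e: 2
      \<comment> \<open>Here \<open>card X' = 2\<close> forces \<open>q = 4\<close>, and
        \<open>V\<close> consists of three edges spanning two classes: the graph with parts 3,
        3.\<close>
      have "exceptional p V q"
        using e Y * by (intro exceptional_pairs[of X' "F' Y" "F' Z" "{}"]) auto
      with exc show ?thesis by simp
    qed
  next
    case 3
    then obtain Y Z where D: "D = {Y, Z}" "Y \<noteq> Z" by (auto simp: card_2_iff)
    have "3 \<le> card Y" "3 \<le> card Z" using rest[of Y] rest[of Z] D 3 by (auto simp: insert_Diff_if)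
    moreover have "Y \<in> P" using D by (auto simp: D_def)
    ultimately have "\<And>C. C \<in> D \<Longrightarrow> 3 \<le> card C" "3 \<le> card X" using D maxX[of Y] by auto
    with drained[of "\<lambda>_. 3"] obtain X' F' where *: "X' \<union> (\<Union>C\<in>D. F' C) = V"
      "disjoint_family_on F' D" "\<forall>C\<in>D. X' \<inter> F' C = {} \<and> card (F' C) = 3" "card X \<le> card X'" "finite X'"
      "\<forall>C\<in>D. finite (F' C)" "card V = card X' + (\<Sum>C\<in>D. 3)"
      "(\<Sum>C\<in>P. ecount p C) \<le> ecount p X' + (\<Sum>C\<in>D. ecount p (F' C))" by blast
    have Y: "V = X' \<union> F' Y \<union> F' Z" "F' Y \<inter> F' Z = {}" "X' \<inter> F' Y = {}" "X' \<inter> F' Z = {}"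
      "card (F' Y) = 3" "card (F' Z) = 3" "finite (F' Y)" "finite (F' Z)" "card X' + 2 = q - 1"
      "(\<Sum>C\<in>P. ecount p C) \<le> ecount p X' + ecount p (F' Y) + ecount p (F' Z)"
      using * D m 3 by (auto simp: disjoint_family_on_def)
    have "3 \<le> card X'" using * \<open>3 \<le> card X\<close> by simp
    with extend_triple_triple[of V X' "F' Y" "F' Z" p] Y fin
    consider T where "T \<subseteq> V" "card T = card X' + 2" "ecount p X' + ecount p (F' Y) + ecount p (F' Z) \<le> ecount p T"
      | I where "card I = 3" "bij_betw p X' I" "bij_betw p (F' Y) I" "bij_betw p (F' Z) I"
      by auto
    then show ?thesis
    proof cases
      case 1
      then show ?thesis using Y by (intro exI[of _ T]) auto
    next
      case e: 2
      \<comment> \<open>Hence \<open>q = 6\<close>, and \<open>V\<close> has nine vertices, three in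
        each class.\<close>
      have "card X' = 3" using e by (metis bij_betw_same_card)
      then have "exceptional p V q"
        using e Y * by (intro exceptional_triples[of X' "F' Y" "F' Z" I]) auto
      with exc show ?thesis by simp
    qed
  next
    case 4
    then obtain A B C where ABC: "D = {A, B, C}" "A \<noteq> B" "A \<noteq> C" "B \<noteq> C" by (auto simp: card_3_iff)
    have "3 \<le> card A + card B" "3 \<le> card A + card C" "3 \<le> card B + card C"
      using rest[of A] rest[of B] rest[of C] ABC 4 by (auto simp: insert_Diff_if)
    \<comment> \<open>At most one of the three blocks is a singleton, as two singletons would total
      less than 3. The other two become \<open>Y\<close> and \<open>Z\<close>, and \<open>W\<close>
      is drained to a single vertex.\<close>
    then have "2 \<le> card A \<and> 2 \<le> card B \<or> 2 \<le> card A \<and> 2 \<le> card C \<or> 2 \<le> card B \<and> 2 \<le> card C"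
      by linarith
    moreover have "D = {A, C, B}" "D = {B, C, A}" using ABC by auto
    ultimately obtain Y Z W where D: "D = {Y, Z, W}" "Y \<noteq> Z" "Y \<noteq> W" "Z \<noteq> W" "2 \<le> card Y" "2 \<le> card Z"
      using ABC by metis
    define t :: "'a set \<Rightarrow> nat" where "t C = (if C = W then 1 else 2)" for C
    have YWP: "Y \<in> P" "W \<in> P" using D by (auto simp: D_def)
    then have "\<And>C. C \<in> D \<Longrightarrow> t C \<le> card C" using D pos[of W] by (auto simp: t_def)
    with drained[of t] obtain X' F' where *: "X' \<union> (\<Union>C\<in>D. F' C) = V"
      "disjoint_family_on F' D" "\<forall>C\<in>D. X' \<inter> F' C = {} \<and> card (F' C) = t C" "card X \<le> card X'" "finite X'"
      "\<forall>C\<in>D. finite (F' C)" "card V = card X' + (\<Sum>C\<in>D. t C)"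
      "(\<Sum>C\<in>P. ecount p C) \<le> ecount p X' + (\<Sum>C\<in>D. ecount p (F' C))" by blast
    have t: "t Y = 2" "t Z = 2" "t W = 1" using D by (auto simp: t_def)
    have W0: "ecount p (F' W) = 0" using * D t by (intro ecount_le_1) auto
    have Y: "V = X' \<union> F' Y \<union> F' Z \<union> F' W" "F' Y \<inter> F' Z = {}" "X' \<inter> F' Y = {}" "X' \<inter> F' Z = {}"
      "F' W \<inter> (X' \<union> F' Y \<union> F' Z) = {}" "card (F' W) = 1"
      "card (F' Y) = 2" "card (F' Z) = 2" "finite (F' Y)" "finite (F' Z)" "card X' + 1 = q - 1"
      "(\<Sum>C\<in>P. ecount p C) \<le> ecount p X' + ecount p (F' Y) + ecount p (F' Z)"
      using * D m 4 t W0 by (auto simp: disjoint_family_on_def)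
    have "2 \<le> card X'" using * D maxX[OF YWP(1)] by linarith
    with extend_pair_pair[of V X' "F' Y" "F' Z" p] Y fin
    consider T where "T \<subseteq> V" "card T = card X' + 1" "ecount p X' + ecount p (F' Y) + ecount p (F' Z) \<le> ecount p T"
      | "card X' = 2" "ecount p X' = 1" "ecount p (F' Y) = 1" "ecount p (F' Z) = 1"
        "\<forall>u\<in>V. \<forall>v\<in>V. \<forall>w\<in>V. p u = p v \<or> p u = p w \<or> p v = p w"
      by auto
    then show ?thesis
    proof cases
      case 1
      then show ?thesis using Y by (intro exI[of _ T]) auto
    next
      case e: 2
      \<comment> \<open>Again \<open>q = 4\<close>; the vertex left in \<open>W\<close> is the
        seventh and yields parts 4, 3.\<close>
      have "exceptional p V q"
        using e Y *(5) by (intro exceptional_pairs[of X' "F' Y" "F' Z" "F' W"]) (auto simp: card_1_singleton_iff)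
      with exc show ?thesis by simp
    qed
  qed
qed

subsection \<open>The extremal number\<close>

lemma not_exceptional:
  assumes "finite (verts G)" "edges G = cross_edges p (verts G)"
    and "\<not> (complete_multipartite [3, 3] G \<and> q = 4)"
    and "\<not> (complete_multipartite [4, 3] G \<and> q = 4)"
    and "\<not> (complete_multipartite [3, 3, 3] G \<and> q = 6)"
  shows "\<not> exceptional p (verts G) q"
proof
  assume "exceptional p (verts G) q"
  then obtain cs where cs: "distinct cs \<and> p ` verts G \<subseteq> set cs \<and>
    (map (\<lambda>c. card {v \<in> verts G. p v = c}) cs, q) \<in> {([3, 3], 4), ([4, 3], 4), ([3, 3, 3], 6)}"
    unfolding exceptional_def by (rule exE)
  then have "complete_multipartite (map (\<lambda>c. card {v \<in> verts G. p v = c}) cs) G"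
    using assms(1,2) by (intro complete_multipartite_classes) simp_all
  with cs assms(3-5) show False by auto
qed

text \<open>The deletion isolates every vertex of \<open>S\<close>, so no path from outside can
  enter \<open>S\<close>.\<close>

lemma components_delete_incident:
  assumes E: "edges H = edges G - incident_edges G S" and V: "verts H = verts G" and S: "S \<subseteq> verts G"
    and C: "C \<in> components H"
  shows "C \<subseteq> verts G - S \<or> (\<exists>v\<in>S. C = {v})"
proof -
  obtain u where u: "u \<in> verts G" "C = {v \<in> verts G. reachable H u v}"
    using C V by (auto simp: components_def)
  have edge: "x \<notin> S \<and> y \<notin> S" if "{x, y} \<in> edges H" for x y
    using that E by (auto simp: incident_edges_def)
  \<comment> \<open>Invariant along a path: either it is still at its start, or both its ends avoid
    \<open>S\<close>.\<close>
  have reach: "v = u \<or> u \<notin> S \<and> v \<notin> S" if "reachable H u v" for v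
    using that unfolding reachable_def by (induction rule: rtrancl_induct) (use edge in auto)
  show ?thesis
  proof (cases "u \<in> S")
    case True
    then have "C = {u}" using u reach by auto
    then show ?thesis using True by blast
  next
    case False
    then have "C \<subseteq> verts G - S" using u reach by auto
    then show ?thesis by blast
  qed
qed

lemma spanning_subgraph_card_edges_bound:
  assumes G: "finite (verts G)" "edges G = cross_edges p (verts G)"
    and H: "spanning_subgraph H G" "\<not> connected_graph H" "comp_order 1 H + comp_order 2 H \<le> q"
    and q: "card (verts G) - 3 \<le> q" "q \<le> card (verts G) - 1" "2 \<le> q"
    and exc: "\<not> exceptional p (verts G) q"
  shows "\<exists>T\<subseteq>verts G. card T = q - 1 \<and> card (edges H) \<le> ecount p T"
proof -
  have V: "verts H = verts G" and E: "edges H \<subseteq> cross_edges p (verts H)"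
    using H(1) G(2) by (auto simp: spanning_subgraph_def)
  have fin: "finite (components H)"
    using finite_elements[OF _ partition_on_components, of H] G(1) V by simp
  have "verts H \<noteq> {}" using q V by auto
  then have two: "2 \<le> card (components H)"
    using H(2) connected_graph_components[of H] G(1) V by simp
  then have sums: "card C + card C' \<le> q"
    if "C \<in> components H" "C' \<in> components H" "C \<noteq> C'" for C C'
    using H(3) comp_order_le_iff[OF fin] that by blast
  obtain T where "T \<subseteq> verts G" "card T = q - 1" "(\<Sum>C\<in>components H. ecount p C) \<le> ecount p T"
    using partition_ecount_bound[OF G(1) _ two sums q exc] partition_on_components[of H] V by auto
  moreover have "card (edges H) \<le> (\<Sum>C\<in>components H. ecount p C)"
    using card_edges_le_components[of H p] E G(1) V by simp
  ultimately show ?thesis by (meson order_trans)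
qed

text \<open>The lower bound. The vertices of \<open>S\<close> are isolated and the other components
  share \<open>q - 1\<close> vertices, so two components have total at most \<open>q - 1\<close>, at
  most \<open>(q - 1) + 1\<close>, or 2, according to how many of them are singletons from
  \<open>S\<close>.\<close>

lemma delete_incident_feasible:
  assumes G: "finite (verts G)" and S: "S \<subseteq> verts G" "card S = card (verts G) - q + 1"
    and q: "q \<le> card (verts G) - 1" "2 \<le> q"
    and H: "H = \<lparr>verts = verts G, edges = edges G - incident_edges G S\<rparr>"
  shows "spanning_subgraph H G \<and> \<not> connected_graph H \<and> comp_order 1 H + comp_order 2 H \<le> q"
proof -
  have V: "verts H = verts G" and E: "edges H = edges G - incident_edges G S" by (simp_all add: H)
  have finS: "finite S" using G S(1) finite_subset by blast
  have comp: "C \<subseteq> verts G - S \<or> (\<exists>v\<in>S. C = {v})" if "C \<in> components H" for C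
    using components_delete_incident[OF E V S(1) that] .
  have part: "partition_on (verts G) (components H)" using partition_on_components[of H] V by simp
  have fin: "finite (components H)" using finite_elements[OF G part] .
  have sing: "{v} \<in> components H" if "v \<in> S" for v
  proof -
    from that S(1) part obtain C where C: "C \<in> components H" "v \<in> C" by (auto simp: partition_on_def)
    with comp[OF C(1)] that show ?thesis by auto
  qed
  \<comment> \<open>\<open>S\<close> has \<open>n - q + 1 \<ge> 2\<close> vertices, so the isolated
    ones alone already disconnect \<open>H\<close>.\<close>
  have "card S = card ((\<lambda>v. {v}) ` S)" by (simp add: card_image)
  also have "\<dots> \<le> card (components H)" using sing fin by (intro card_mono) auto
  finally have two: "2 \<le> card (components H)" using S q by simp
  have rest: "card (verts G - S) = q - 1"
    using S q finS by (simp add: card_Diff_subset)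
  have sums: "card C + card C' \<le> q" if CC: "C \<in> components H" "C' \<in> components H" "C \<noteq> C'" for C C'
  proof -
    have fC: "finite C" "finite C'" and disj: "C \<inter> C' = {}"
      using CC part G by (auto simp: partition_on_def disjoint_def intro: finite_subset)
    have le: "card B \<le> q - 1" if "B \<subseteq> verts G - S" for B
      using card_mono[OF _ that] G rest by simp
    consider "C \<subseteq> verts G - S" "C' \<subseteq> verts G - S" | "C \<subseteq> verts G - S" "card C' = 1"
      | "card C = 1" "C' \<subseteq> verts G - S" | "card C = 1" "card C' = 1"
      using comp[OF CC(1)] comp[OF CC(2)] by (auto simp: card_1_singleton_iff)
    then show ?thesis
    proof cases
      case 1
      then have "card (C \<union> C') \<le> q - 1" by (intro le) auto
      then show ?thesis using fC disj by (simp add: card_Un_disjoint)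
    qed (use le[of C] le[of C'] q in auto)
  qed
  have "verts H \<noteq> {}" using q V by auto
  then have "\<not> connected_graph H" using connected_graph_components[of H] G V two by simp
  moreover have "comp_order 1 H + comp_order 2 H \<le> q" using comp_order_le_iff[OF fin two] sums by blast
  ultimately show ?thesis by (auto simp: spanning_subgraph_def H)
qed

theorem theorem4p1:
  fixes G :: "'a ugraph" and ps :: "nat list" and n q :: nat
  assumes "2 \<le> length ps"
    and "sorted_wrt (\<ge>) ps"
    and "\<forall>p\<in>set ps. 1 \<le> p"
    and "complete_multipartite ps G"
    and "n = sum_list ps"
    and "n - 3 \<le> q" and "q \<le> n - 1" and "2 \<le> q"
    and "\<not> (complete_multipartite [3, 3] G \<and> q = 4)"
    and "\<not> (complete_multipartite [4, 3] G \<and> q = 4)"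
    and "\<not> (complete_multipartite [3, 3, 3] G \<and> q = 6)"
  shows "int (ell q G) =
    int (card (edges G)) - int (Min ((\<lambda>S. card (incident_edges G S)) ` nsets (verts G) (n - q + 1)))"
proof -
  obtain p :: "'a \<Rightarrow> nat" where E: "edges G = cross_edges p (verts G)" and n: "card (verts G) = n"
    using complete_multipartite_cross_edges[OF assms(4)] assms(5) by metis
  have fin: "finite (verts G)" using assms(4) by (rule complete_multipartite_simple)
  have finE: "finite (edges G)" using E fin finite_cross_edges by metis
  define inc where "inc S = card (incident_edges G S)" for S
  define N where "N = nsets (verts G) (n - q + 1)"
  define M where "M = {card (edges H) | H. spanning_subgraph H G \<and> \<not> connected_graph H \<and>
    comp_order 1 H + comp_order 2 H \<le> q}"
  have exc: "\<not> exceptional p (verts G) q" using not_exceptional[OF fin E] assms(9-11) by blast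
  have N: "S \<in> N \<longleftrightarrow> S \<subseteq> verts G \<and> card S = n - q + 1" for S
    using fin by (auto simp: N_def nsets_def intro: finite_subset)
  have finN: "finite N" using fin by (simp add: N_def finite_imp_finite_nsets)
  have eq: "ecount p (verts G - S) + inc S = card (edges G)" if "S \<subseteq> verts G" for S
    using ecount_plus_incident(1)[OF fin E that] by (simp add: inc_def)
  have "n - q + 1 \<le> card (verts G)" using n assms(7,8) by simp
  then have "N \<noteq> {}" using N by (metis obtain_subset_with_card_n empty_iff)
  then have "Min (inc ` N) \<in> inc ` N" using finN by simp
  then obtain S where S: "S \<in> N" "Min (inc ` N) = inc S" by blast
  have "ell q G = Max M" by (simp add: ell_def M_def)
  \<comment> \<open>As \<open>S\<close> minimises the incident edges, its complement spans the most
    edges among sets of size \<open>q - 1\<close>.\<close>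
  also have "Max M = ecount p (verts G - S)"
  proof (rule Max_eqI)
    show "finite M"
      using finE by (intro finite_subset[of M "{..card (edges G)}"])
        (auto simp: M_def spanning_subgraph_def intro: card_mono)
  next
    fix y assume "y \<in> M"
    then obtain H where H: "y = card (edges H)" "spanning_subgraph H G" "\<not> connected_graph H"
      "comp_order 1 H + comp_order 2 H \<le> q" by (auto simp: M_def)
    obtain T where T: "T \<subseteq> verts G" "card T = q - 1" "y \<le> ecount p T"
      using spanning_subgraph_card_edges_bound[OF fin E H(2-4) _ _ _ exc] n H(1) assms(6-8) by auto
    \<comment> \<open>The complement of \<open>T\<close> competes with \<open>S\<close> in the
      minimum.\<close>
    have "card (verts G - T) = n - q + 1"
      using T n fin assms(7,8) by (simp add: card_Diff_subset finite_subset)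
    then have "inc S \<le> inc (verts G - T)"
      unfolding S(2)[symmetric] using finN N by (intro Min_le) auto
    moreover have "verts G - (verts G - T) = T" using T(1) by blast
    ultimately show "y \<le> ecount p (verts G - S)"
      using eq[of S] eq[of "verts G - T"] T(3) S(1) N by auto
  next
    define H where "H = \<lparr>verts = verts G, edges = edges G - incident_edges G S\<rparr>"
    have "spanning_subgraph H G \<and> \<not> connected_graph H \<and> comp_order 1 H + comp_order 2 H \<le> q"
      using S(1) N n assms(7,8) by (intro delete_incident_feasible[OF fin _ _ _ _ H_def]) auto
    moreover have "card (edges H) = ecount p (verts G - S)"
      using ecount_plus_incident(2)[OF fin E, of S] S(1) N by (simp add: H_def ecount_def)
    ultimately show "ecount p (verts G - S) \<in> M" unfolding M_def by force
  qed
  finally have "ell q G + Min (inc ` N) = card (edges G)" using eq[of S] S N by simp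
  then show ?thesis by (simp add: inc_def[abs_def] N_def)
qed

end
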